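(* Let $\rho$, $\boldsymbol u=(u_i)$, $p$, $\sigma=(\sigma_{ij})$ be arbitrary smooth fields on $\mathbb R^{1+d}$ (no equations of motion imposed), let $\boldsymbol U\in\mathbb R^d$ be constant, and let $\mathcal C=\partial_t\rho+\nabla\cdot(\rho\boldsymbol u)$ be the continuity residual. Then $$\partial_i\partial_j\bigl(T^{0}_{ij}-T^{\boldsymbol U}_{ij}\bigr)+\bigl(\Box_{\boldsymbol U}-\Box_0\bigr)\rho=2\,(\boldsymbol U\cdot\nabla)\,\mathcal C .$$ In particular, on any fields satisfying mass conservation alone ($\mathcal C=0$), the sources $s_{\boldsymbol U}=\partial_i\partial_jT^{\boldsymbol U}_{ij}$ and $s_0=\partial_i\partial_jT^0_{ij}$ satisfy $s_{\boldsymbol U}=s_0+(\Box_{\boldsymbol U}-\Box_0)\rho'$.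
   Context: Coordinates $(t,\boldsymbol x)\in\mathbb R^{1+d}$, $d\in\{2,3\}$; repeated spatial indices are summed. Fix constants $c>0$ (ambient sound speed), $\rho_0$, $p_0$ (ambient density and pressure), and write $\rho'=\rho-\rho_0$, $p'=p-p_0$. For a constant vector $\boldsymbol v$, $\Box_{\boldsymbol v}=(\partial_t+\boldsymbol v\cdot\nabla)^2-c^2\Delta$ and $$T^{\boldsymbol v}_{ij}=\rho\,(u_i-v_i)(u_j-v_j)+(p'-c^2\rho')\delta_{ij}-\sigma_{ij};$$ $\Box_0$ and $T^0_{ij}$ denote the case $\boldsymbol v=\boldsymbol 0$. *)

theory Defs
  imports "HOL-Analysis.Analysis"
begin

type_synonym 'd spacetime = "real \<times> (real ^ 'd)"

text \<open>
  \<open>n\<close>-fold continuous differentiability on the whole space. Instead of iterating the Frechet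
  derivative as a multilinear map (whose type would change with \<open>n\<close>), the recursion runs over the
  directional derivatives in every fixed direction; in finite dimension this is the usual \<open>C\<^sup>n\<close>.
\<close>

primrec C_n :: "nat \<Rightarrow> ('a::real_normed_vector \<Rightarrow> 'b::real_normed_vector) \<Rightarrow> bool" where
  "C_n 0 f \<longleftrightarrow> continuous_on UNIV f"
| "C_n (Suc n) f \<longleftrightarrow>
     (\<forall>x. f differentiable (at x)) \<and> (\<forall>v. C_n n (\<lambda>x. frechet_derivative f (at x) v))"

definition smooth :: "('a::real_normed_vector \<Rightarrow> 'b::real_normed_vector) \<Rightarrow> bool" where
  "smooth f \<longleftrightarrow> (\<forall>n. C_n n f)"

definition d_t :: "('d::finite spacetime \<Rightarrow> real) \<Rightarrow> 'd spacetime \<Rightarrow> real" where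
  "d_t f z = deriv (\<lambda>s. f (s, snd z)) (fst z)"

definition d_x :: "'d::finite \<Rightarrow> ('d spacetime \<Rightarrow> real) \<Rightarrow> 'd spacetime \<Rightarrow> real" where
  "d_x i f z = deriv (\<lambda>h. f (fst z, snd z + h *\<^sub>R axis i 1)) 0"

definition laplacian :: "('d::finite spacetime \<Rightarrow> real) \<Rightarrow> 'd spacetime \<Rightarrow> real" where
  "laplacian f z = (\<Sum>i\<in>UNIV. d_x i (d_x i f) z)"

definition advect :: "real ^ 'd::finite \<Rightarrow> ('d spacetime \<Rightarrow> real) \<Rightarrow> 'd spacetime \<Rightarrow> real" where
  "advect v f z = (\<Sum>i\<in>UNIV. v $ i * d_x i f z)"

definition convective :: "real ^ 'd::finite \<Rightarrow> ('d spacetime \<Rightarrow> real) \<Rightarrow> 'd spacetime \<Rightarrow> real" where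
  "convective v f z = d_t f z + advect v f z"

definition wave_op :: "real \<Rightarrow> real ^ 'd::finite \<Rightarrow> ('d spacetime \<Rightarrow> real) \<Rightarrow> 'd spacetime \<Rightarrow> real" where
  "wave_op c v f z = convective v (convective v f) z - c\<^sup>2 * laplacian f z"

definition stress ::
  "real \<Rightarrow> real \<Rightarrow> real \<Rightarrow> ('d::finite spacetime \<Rightarrow> real) \<Rightarrow> ('d spacetime \<Rightarrow> real ^ 'd) \<Rightarrow>
   ('d spacetime \<Rightarrow> real) \<Rightarrow> ('d spacetime \<Rightarrow> real ^ 'd ^ 'd) \<Rightarrow> real ^ 'd \<Rightarrow>
   'd spacetime \<Rightarrow> real ^ 'd ^ 'd" where
  "stress c \<rho>0 p0 \<rho> u p \<sigma> v z =
     (\<chi> i j. \<rho> z * (u z $ i - v $ i) * (u z $ j - v $ j)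
        + ((p z - p0) - c\<^sup>2 * (\<rho> z - \<rho>0)) * (if i = j then 1 else 0)
        - \<sigma> z $ i $ j)"

definition double_div :: "('d::finite spacetime \<Rightarrow> real ^ 'd ^ 'd) \<Rightarrow> 'd spacetime \<Rightarrow> real" where
  "double_div T z = (\<Sum>i\<in>UNIV. \<Sum>j\<in>UNIV. d_x i (d_x j (\<lambda>y. T y $ i $ j)) z)"

definition continuity_residual ::
  "('d::finite spacetime \<Rightarrow> real) \<Rightarrow> ('d spacetime \<Rightarrow> real ^ 'd) \<Rightarrow> 'd spacetime \<Rightarrow> real" where
  "continuity_residual \<rho> u z = d_t \<rho> z + (\<Sum>i\<in>UNIV. d_x i (\<lambda>y. \<rho> y * u y $ i) z)"

end

theory Submission
  imports Defs
begin

text \<open>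
  The entries of \<open>T\<^sup>0 - T\<^sup>U\<close> are \<open>U\<^sub>i \<rho>u\<^sub>j + U\<^sub>j \<rho>u\<^sub>i - U\<^sub>i U\<^sub>j \<rho>\<close>, so their double divergence is
  \<open>2 (U \<cdot> \<nabla>)(\<nabla> \<cdot> \<rho>u) - (U \<cdot> \<nabla>)\<^sup>2 \<rho>\<close>, while the two wave operators differ by
  \<open>2 (U \<cdot> \<nabla>) \<partial>\<^sub>t + (U \<cdot> \<nabla>)\<^sup>2\<close>. Both computations need only that partial derivatives of smooth
  functions commute; this is obtained from the limit of the mixed second difference quotient.
\<close>

section \<open>Directional derivatives and closure properties of C^n functions\<close>

text \<open>With the direction first, the operator can be iterated and matches the recursion of
  \<open>C_n\<close>; time and space partials become the directions \<open>(1, 0)\<close> and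
  \<open>(0, axis i 1)\<close>.\<close>

definition dir_deriv ::
  "'a::real_normed_vector \<Rightarrow> ('a \<Rightarrow> 'b::real_normed_vector) \<Rightarrow> 'a \<Rightarrow> 'b" where
  "dir_deriv v f z = frechet_derivative f (at z) v"

lemma dir_deriv_eqI: "(f has_derivative f') (at z) \<Longrightarrow> dir_deriv v f z = f' v"
  unfolding dir_deriv_def using frechet_derivative_at by metis

lemma C_n_Suc_iff:
  "C_n (Suc n) f \<longleftrightarrow> (\<forall>z. f differentiable (at z)) \<and> (\<forall>v. C_n n (dir_deriv v f))"
  by (simp add: dir_deriv_def[abs_def])

text \<open>Differentiability gives continuity at level 0; above that, the induction hypothesis is
  applied to every directional derivative, hence the generalization over \<open>f\<close>.\<close>

lemma C_n_SucD: "C_n (Suc n) f \<Longrightarrow> C_n n f"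
proof (induction n arbitrary: f)
  case 0
  then show ?case
    by (auto simp: continuous_on_eq_continuous_at differentiable_imp_continuous_within)
next
  case (Suc n)
  then show ?case unfolding C_n_Suc_iff[of "Suc n"] C_n_Suc_iff[of n f] by blast
qed

lemma C_n_const: "C_n n (\<lambda>z. k)"
proof (induction n arbitrary: k)
  case (Suc n)
  have "dir_deriv v (\<lambda>z. k) = (\<lambda>z. 0)" for v :: 'a
    by (auto intro!: dir_deriv_eqI[THEN trans] derivative_eq_intros)
  with Suc show ?case by (simp only: C_n_Suc_iff) simp
qed simp

lemma C_n_add: "C_n n f \<Longrightarrow> C_n n g \<Longrightarrow> C_n n (\<lambda>z. f z + g z)"
proof (induction n arbitrary: f g)
  case (Suc n)
  from Suc.prems have df: "f differentiable (at z)" and dg: "g differentiable (at z)" for z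
    by (simp_all add: C_n_Suc_iff del: C_n.simps)
  have "dir_deriv v (\<lambda>z. f z + g z) = (\<lambda>z. dir_deriv v f z + dir_deriv v g z)" for v
    using has_derivative_add[OF frechet_derivative_works[THEN iffD1, OF df] frechet_derivative_works[THEN iffD1, OF dg]]
    by (auto simp: dir_deriv_def[of _ f] dir_deriv_def[of _ g] dest: dir_deriv_eqI)
  with Suc df dg show ?case by (simp del: C_n.simps add: C_n_Suc_iff)
qed (auto intro: continuous_intros)

lemma C_n_mult:
  fixes f g :: "'a::real_normed_vector \<Rightarrow> real"
  shows "C_n n f \<Longrightarrow> C_n n g \<Longrightarrow> C_n n (\<lambda>z. f z * g z)"
proof (induction n arbitrary: f g)
  case (Suc n)
  from Suc.prems have df: "f differentiable (at z)" and dg: "g differentiable (at z)" for z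
    by (simp_all add: C_n_Suc_iff del: C_n.simps)
  have "dir_deriv v (\<lambda>z. f z * g z) = (\<lambda>z. f z * dir_deriv v g z + dir_deriv v f z * g z)" for v
    using has_derivative_mult[OF frechet_derivative_works[THEN iffD1, OF df] frechet_derivative_works[THEN iffD1, OF dg]]
    by (auto simp: dir_deriv_def[of _ f] dir_deriv_def[of _ g] dest: dir_deriv_eqI)
  \<comment> \<open>The product rule leaves undifferentiated factors \<open>f\<close> and
    \<open>g\<close>, known to be C^(n+1); \<open>C_n_SucD\<close> lowers them to the level of the
    induction hypothesis.\<close>
  with Suc df dg show ?case
    by (auto simp del: C_n.simps simp: C_n_Suc_iff
        intro!: C_n_add Suc.IH C_n_SucD[of n f] C_n_SucD[of n g])
qed (auto intro: continuous_intros)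

text \<open>A bounded linear map commutes with differentiation. This serves for negation and for
  taking components of vectors and matrices.\<close>

lemma C_n_bounded_linear:
  assumes "bounded_linear L"
  shows "C_n n f \<Longrightarrow> C_n n (\<lambda>z. L (f z))"
proof (induction n arbitrary: f)
  case 0
  then show ?case by (auto intro: bounded_linear.continuous_on[OF assms])
next
  case (Suc n)
  from Suc.prems have df: "f differentiable (at z)" for z
    by (simp_all add: C_n_Suc_iff del: C_n.simps)
  note der = bounded_linear.has_derivative[OF assms frechet_derivative_works[THEN iffD1, OF df]]
  have "dir_deriv v (\<lambda>z. L (f z)) = (\<lambda>z. L (dir_deriv v f z))" for v
    using der by (auto simp: dir_deriv_def[of _ f] dest: dir_deriv_eqI)
  with Suc der show ?case by (auto simp del: C_n.simps simp: C_n_Suc_iff differentiable_def)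
qed

section \<open>Closure properties of smooth functions\<close>

lemma smooth_const: "smooth (\<lambda>z. k)"
  by (simp add: smooth_def C_n_const)

lemma smooth_add: "smooth f \<Longrightarrow> smooth g \<Longrightarrow> smooth (\<lambda>z. f z + g z)"
  by (simp add: smooth_def C_n_add)

lemma smooth_mult:
  fixes f g :: "'a::real_normed_vector \<Rightarrow> real"
  shows "smooth f \<Longrightarrow> smooth g \<Longrightarrow> smooth (\<lambda>z. f z * g z)"
  by (simp add: smooth_def C_n_mult)

lemma smooth_bounded_linear: "bounded_linear L \<Longrightarrow> smooth f \<Longrightarrow> smooth (\<lambda>z. L (f z))"
  by (simp add: smooth_def C_n_bounded_linear)

lemma smooth_diff: "smooth f \<Longrightarrow> smooth g \<Longrightarrow> smooth (\<lambda>z. f z - g z)"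
  using smooth_add[of f "\<lambda>z. - g z"]
    smooth_bounded_linear[OF bounded_linear_minus[OF bounded_linear_ident], of g] by simp

lemma smooth_sum: "(\<And>i. i \<in> A \<Longrightarrow> smooth (f i)) \<Longrightarrow> smooth (\<lambda>z. \<Sum>i\<in>A. f i z)"
  by (induction A rule: infinite_finite_induct) (auto intro: smooth_const smooth_add)

lemma smooth_vec_nth: "smooth f \<Longrightarrow> smooth (\<lambda>z. f z $ i)"
  by (rule smooth_bounded_linear[OF bounded_linear_vec_nth])

lemma smooth_imp_continuous: "smooth f \<Longrightarrow> continuous_on UNIV f"
  unfolding smooth_def using C_n.simps(1) by blast

lemma smooth_imp_differentiable: "smooth f \<Longrightarrow> f differentiable (at z)"
  unfolding smooth_def using C_n.simps(2) by blast

lemma smooth_dir_deriv: "smooth f \<Longrightarrow> smooth (dir_deriv v f)"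
  unfolding smooth_def using C_n_Suc_iff by blast

lemma smooth_has_derivative: "smooth f \<Longrightarrow> (f has_derivative (\<lambda>v. dir_deriv v f z)) (at z)"
  unfolding dir_deriv_def using frechet_derivative_works smooth_imp_differentiable by metis

section \<open>Symmetry of second derivatives\<close>

text \<open>The chain rule along a line reduces directional derivatives to one-variable calculus, as
  needed both for the mean value theorem and for the \<open>deriv\<close> in \<open>d_t\<close> and
  \<open>d_x\<close>.\<close>

lemma smooth_has_real_derivative_line:
  fixes f :: "'a::real_normed_vector \<Rightarrow> real"
  assumes "smooth f"
  shows "((\<lambda>s. f (z + s *\<^sub>R v)) has_real_derivative dir_deriv v f (z + s *\<^sub>R v)) (at s)"
proof -
  have D: "(f has_derivative (\<lambda>w. dir_deriv w f (z + s *\<^sub>R v))) (at (z + s *\<^sub>R v))"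
    by (rule smooth_has_derivative[OF assms])
  have "((\<lambda>s. z + s *\<^sub>R v) has_derivative (\<lambda>h. h *\<^sub>R v)) (at s)"
    by (auto intro!: derivative_eq_intros)
  from has_derivative_compose[OF this D]
  show ?thesis
    by (simp add: has_field_derivative_def
        linear_scale[OF has_derivative_linear[OF D]] mult_commute_abs)
qed

text \<open>The mean value theorem is used twice: along \<open>v\<close> for the increment of
  \<open>f\<close> in direction \<open>w\<close>, then along \<open>w\<close> for
  \<open>dir_deriv v f\<close>.\<close>

lemma mixed_difference_MVT:
  fixes f :: "'a::real_normed_vector \<Rightarrow> real"
  assumes f: "smooth f" and h: "0 < h"
  shows "\<exists>\<xi> \<eta>. 0 < \<xi> \<and> \<xi> < h \<and> 0 < \<eta> \<and> \<eta> < h \<and>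
    f (z + h *\<^sub>R v + h *\<^sub>R w) - f (z + h *\<^sub>R v) - f (z + h *\<^sub>R w) + f z
      = h\<^sup>2 * dir_deriv w (dir_deriv v f) (z + \<xi> *\<^sub>R v + \<eta> *\<^sub>R w)"
proof -
  \<comment> \<open>The second difference of \<open>f\<close> is the increment of this function from
    0 to \<open>h\<close>.\<close>
  define \<phi> where "\<phi> s = f ((z + h *\<^sub>R w) + s *\<^sub>R v) - f (z + s *\<^sub>R v)" for s
  have "(\<phi> has_real_derivative
      dir_deriv v f ((z + h *\<^sub>R w) + s *\<^sub>R v) - dir_deriv v f (z + s *\<^sub>R v)) (at s)" for s
    unfolding \<phi>_def by (intro DERIV_diff smooth_has_real_derivative_line f)
  from MVT2[OF h this] obtain \<xi> where \<xi>: "0 < \<xi>" "\<xi> < h"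
    "\<phi> h - \<phi> 0 = h * (dir_deriv v f ((z + h *\<^sub>R w) + \<xi> *\<^sub>R v) - dir_deriv v f (z + \<xi> *\<^sub>R v))"
    by auto
  from MVT2[OF h, of "\<lambda>s. dir_deriv v f (z + \<xi> *\<^sub>R v + s *\<^sub>R w)",
      OF smooth_has_real_derivative_line[OF smooth_dir_deriv[OF f]]]
  obtain \<eta> where \<eta>: "0 < \<eta>" "\<eta> < h"
    "dir_deriv v f (z + \<xi> *\<^sub>R v + h *\<^sub>R w) - dir_deriv v f (z + \<xi> *\<^sub>R v)
      = h * dir_deriv w (dir_deriv v f) (z + \<xi> *\<^sub>R v + \<eta> *\<^sub>R w)"
    by auto
  have "f (z + h *\<^sub>R v + h *\<^sub>R w) - f (z + h *\<^sub>R v) - f (z + h *\<^sub>R w) + f z = \<phi> h - \<phi> 0"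
    by (simp add: \<phi>_def add_ac)
  also have "\<dots> = h\<^sup>2 * dir_deriv w (dir_deriv v f) (z + \<xi> *\<^sub>R v + \<eta> *\<^sub>R w)"
    using \<xi>(3) \<eta>(3) by (simp add: add_ac power2_eq_square)
  finally show ?thesis using \<xi> \<eta> by blast
qed

lemma mixed_difference_quotient_tendsto:
  fixes f :: "'a::real_normed_vector \<Rightarrow> real"
  assumes f: "smooth f"
  shows "((\<lambda>h. (f (z + h *\<^sub>R v + h *\<^sub>R w) - f (z + h *\<^sub>R v) - f (z + h *\<^sub>R w) + f z) / h\<^sup>2)
    \<longlongrightarrow> dir_deriv w (dir_deriv v f) z) (at_right 0)"
proof -
  let ?\<Delta> = "\<lambda>h. f (z + h *\<^sub>R v + h *\<^sub>R w) - f (z + h *\<^sub>R v) - f (z + h *\<^sub>R w) + f z"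
  let ?g = "dir_deriv w (dir_deriv v f)"
  \<comment> \<open>The condition \<open>0 < h\<close> sits inside the existentials so that choice
    yields functions \<open>a\<close> and \<open>b\<close> on all reals.\<close>
  have "\<forall>h. \<exists>\<xi> \<eta>. 0 < h \<longrightarrow> 0 < \<xi> \<and> \<xi> < h \<and> 0 < \<eta> \<and> \<eta> < h \<and>
      ?\<Delta> h = h\<^sup>2 * ?g (z + \<xi> *\<^sub>R v + \<eta> *\<^sub>R w)"
    using mixed_difference_MVT[OF f, of _ z v w] by blast
  then obtain a b where ab: "\<And>h. 0 < h \<Longrightarrow> 0 < a h \<and> a h < h \<and> 0 < b h \<and> b h < h \<and>
      ?\<Delta> h = h\<^sup>2 * ?g (z + a h *\<^sub>R v + b h *\<^sub>R w)"
    unfolding choice_iff by blast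
  have pos: "\<forall>\<^sub>F h in at_right (0::real). 0 < h"
    by (rule eventually_at_right_less)
  \<comment> \<open>The intermediate points lie between 0 and \<open>h\<close>, so they tend to 0;
    continuity of the second derivative then gives the limit.\<close>
  have squeeze: "(x \<longlongrightarrow> 0) (at_right 0)" if "\<And>h. 0 < h \<Longrightarrow> 0 < x h \<and> x h < h" for x :: "real \<Rightarrow> real"
    by (rule tendsto_sandwich[OF _ _ tendsto_const tendsto_ident_at])
      (use that in \<open>auto intro: less_imp_le eventually_mono[OF pos]\<close>)
  have "isCont ?g z"
    using smooth_imp_continuous[OF smooth_dir_deriv[OF smooth_dir_deriv[OF f]]]
    by (simp add: continuous_on_eq_continuous_at)
  moreover have "((\<lambda>h. z + a h *\<^sub>R v + b h *\<^sub>R w) \<longlongrightarrow> z + 0 *\<^sub>R v + 0 *\<^sub>R w) (at_right 0)"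
    by (intro tendsto_intros squeeze) (use ab in auto)
  ultimately have "((\<lambda>h. ?g (z + a h *\<^sub>R v + b h *\<^sub>R w)) \<longlongrightarrow> ?g z) (at_right 0)"
    by (simp add: isCont_tendsto_compose[of z ?g])
  then show ?thesis
    by (rule Lim_transform_eventually) (use ab in \<open>auto intro: eventually_mono[OF pos]\<close>)
qed

text \<open>The second difference is symmetric in \<open>v\<close> and \<open>w\<close>, so both
  iterated derivatives are limits of the same quotient.\<close>

lemma dir_deriv_commute:
  fixes f :: "'a::real_normed_vector \<Rightarrow> real"
  assumes "smooth f"
  shows "dir_deriv v (dir_deriv w f) z = dir_deriv w (dir_deriv v f) z"
proof (rule tendsto_unique)
  let ?Q = "\<lambda>h. (f (z + h *\<^sub>R v + h *\<^sub>R w) - f (z + h *\<^sub>R v) - f (z + h *\<^sub>R w) + f z) / h\<^sup>2"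
  show "(?Q \<longlongrightarrow> dir_deriv w (dir_deriv v f) z) (at_right 0)"
    by (rule mixed_difference_quotient_tendsto[OF assms])
  show "(?Q \<longlongrightarrow> dir_deriv v (dir_deriv w f) z) (at_right 0)"
    using mixed_difference_quotient_tendsto[OF assms, of z w v] by (simp add: algebra_simps)
qed simp

section \<open>Calculus of the partial derivatives\<close>

lemma d_t_eq: "smooth f \<Longrightarrow> d_t f = dir_deriv (1, 0) f"
proof
  fix z assume "smooth f"
  \<comment> \<open>\<open>d_t\<close> differentiates at the parameter \<open>fst z\<close>, so the
    line starts at time 0.\<close>
  from smooth_has_real_derivative_line[OF this, of "(0, snd z)" "(1, 0)" "fst z"]
  show "d_t f z = dir_deriv (1, 0) f z" by (simp add: d_t_def DERIV_imp_deriv)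
qed

lemma d_x_eq: "smooth f \<Longrightarrow> d_x i f = dir_deriv (0, axis i 1) f"
proof
  fix z assume "smooth f"
  from smooth_has_real_derivative_line[OF this, of z "(0, axis i 1)" 0]
  show "d_x i f z = dir_deriv (0, axis i 1) f z"
    by (cases z) (simp add: d_x_def DERIV_imp_deriv)
qed

lemma smooth_d_t: "smooth f \<Longrightarrow> smooth (d_t f)"
  by (simp add: d_t_eq smooth_dir_deriv)

lemma smooth_d_x: "smooth f \<Longrightarrow> smooth (d_x i f)"
  by (simp add: d_x_eq smooth_dir_deriv)

lemma d_x_commute: "smooth f \<Longrightarrow> d_x i (d_x j f) = d_x j (d_x i f)"
  by (rule ext) (simp add: d_x_eq smooth_dir_deriv dir_deriv_commute)

lemma d_t_d_x_commute: "smooth f \<Longrightarrow> d_t (d_x i f) = d_x i (d_t f)"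
  by (rule ext) (simp add: d_x_eq d_t_eq smooth_dir_deriv dir_deriv_commute)

lemma dir_deriv_add:
  "smooth f \<Longrightarrow> smooth g \<Longrightarrow>
    dir_deriv v (\<lambda>z. f z + g z) = (\<lambda>z. dir_deriv v f z + dir_deriv v g z)"
  by (rule ext) (rule dir_deriv_eqI, intro has_derivative_add smooth_has_derivative)

lemma dir_deriv_cmult:
  fixes f :: "'a::real_normed_vector \<Rightarrow> real"
  shows "smooth f \<Longrightarrow> dir_deriv v (\<lambda>z. k * f z) = (\<lambda>z. k * dir_deriv v f z)"
  by (rule ext) (rule dir_deriv_eqI, intro has_derivative_mult_right smooth_has_derivative)

lemma d_x_add:
  "smooth f \<Longrightarrow> smooth g \<Longrightarrow> d_x i (\<lambda>z. f z + g z) = (\<lambda>z. d_x i f z + d_x i g z)"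
  by (simp add: d_x_eq smooth_add dir_deriv_add)

lemma smooth_cmult:
  fixes f :: "'a::real_normed_vector \<Rightarrow> real"
  shows "smooth f \<Longrightarrow> smooth (\<lambda>z. k * f z)"
  by (intro smooth_mult smooth_const)

lemma d_x_cmult: "smooth f \<Longrightarrow> d_x i (\<lambda>z. k * f z) = (\<lambda>z. k * d_x i f z)"
  by (simp add: d_x_eq smooth_cmult dir_deriv_cmult)

lemma d_x_diff:
  "smooth f \<Longrightarrow> smooth g \<Longrightarrow> d_x i (\<lambda>z. f z - g z) = (\<lambda>z. d_x i f z - d_x i g z)"
  using d_x_add[of f "\<lambda>z. (-1) * g z" i] d_x_cmult[of g i "-1"] smooth_cmult[of g "-1"] by simp

lemma d_x_const: "d_x i (\<lambda>z. k) = (\<lambda>z. 0)"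
  by (simp add: d_x_def fun_eq_iff)

lemma d_x_sum:
  "(\<And>j. j \<in> A \<Longrightarrow> smooth (f j)) \<Longrightarrow> d_x i (\<lambda>z. \<Sum>j\<in>A. f j z) = (\<lambda>z. \<Sum>j\<in>A. d_x i (f j) z)"
proof (induction A rule: infinite_finite_induct)
  case (insert j A)
  then show ?case by (simp add: d_x_add smooth_sum)
qed (simp_all add: d_x_const)

lemma d_t_add:
  "smooth f \<Longrightarrow> smooth g \<Longrightarrow> d_t (\<lambda>z. f z + g z) = (\<lambda>z. d_t f z + d_t g z)"
  by (simp add: d_t_eq smooth_add dir_deriv_add)

lemma d_t_cmult: "smooth f \<Longrightarrow> d_t (\<lambda>z. k * f z) = (\<lambda>z. k * d_t f z)"
  by (simp add: d_t_eq smooth_cmult dir_deriv_cmult)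

lemma d_t_const: "d_t (\<lambda>z. k) = (\<lambda>z. 0)"
  by (simp add: d_t_def fun_eq_iff)

lemma d_t_sum:
  "(\<And>j. j \<in> A \<Longrightarrow> smooth (f j)) \<Longrightarrow> d_t (\<lambda>z. \<Sum>j\<in>A. f j z) = (\<lambda>z. \<Sum>j\<in>A. d_t (f j) z)"
proof (induction A rule: infinite_finite_induct)
  case (insert j A)
  then show ?case by (simp add: d_t_add smooth_sum)
qed (simp_all add: d_t_const)

section \<open>Advection and the difference of the wave operators\<close>

lemma smooth_advect: "smooth f \<Longrightarrow> smooth (advect v f)"
  unfolding advect_def[abs_def] by (intro smooth_sum smooth_cmult smooth_d_x)

lemma advect_add:
  "smooth f \<Longrightarrow> smooth g \<Longrightarrow> advect v (\<lambda>z. f z + g z) = (\<lambda>z. advect v f z + advect v g z)"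
  by (simp add: advect_def fun_eq_iff d_x_add distrib_left sum.distrib)

text \<open>The coefficients of \<open>v\<close> are constant and \<open>d_t\<close> commutes with
  each \<open>d_x i\<close>.\<close>

lemma d_t_advect: "smooth f \<Longrightarrow> d_t (advect v f) = advect v (d_t f)"
  unfolding advect_def[abs_def]
  by (simp add: d_t_sum d_t_cmult smooth_cmult smooth_d_x d_t_d_x_commute)

lemma advect_advect:
  "smooth f \<Longrightarrow> advect v (advect v f) z = (\<Sum>i\<in>UNIV. \<Sum>j\<in>UNIV. v $ i * v $ j * d_x i (d_x j f) z)"
  unfolding advect_def[abs_def]
  by (simp add: d_x_sum d_x_cmult smooth_cmult smooth_d_x sum_distrib_left mult.assoc)

lemma advect_divergence:
  assumes "\<And>j. smooth (m j)"
  shows "advect v (\<lambda>z. \<Sum>j\<in>UNIV. d_x j (m j) z) z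
    = (\<Sum>i\<in>UNIV. \<Sum>j\<in>UNIV. v $ i * d_x i (d_x j (m j)) z)"
  unfolding advect_def by (simp add: d_x_sum smooth_d_x assms sum_distrib_left)

text \<open>The Laplacians and the second time derivatives cancel; the two mixed terms of the
  squared convective derivative coincide by \<open>d_t_advect\<close>.\<close>

lemma wave_op_diff:
  assumes f: "smooth f"
  shows "wave_op c v f z - wave_op c 0 f z = 2 * advect v (d_t f) z + advect v (advect v f) z"
proof -
  have "convective v g = (\<lambda>z. d_t g z + advect v g z)" for v and g :: "'a spacetime \<Rightarrow> real"
    by (simp add: convective_def fun_eq_iff)
  moreover have "advect 0 g = (\<lambda>z. 0)" for g :: "'a spacetime \<Rightarrow> real"
    by (simp add: advect_def fun_eq_iff)
  ultimately show ?thesis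
    by (simp add: wave_op_def f d_t_add smooth_d_t smooth_advect d_t_advect advect_add)
qed

section \<open>Double divergence of the stress tensors\<close>

lemma double_div_diff:
  assumes "\<And>i j. smooth (\<lambda>y. S y $ i $ j)" and "\<And>i j. smooth (\<lambda>y. T y $ i $ j)"
  shows "double_div (\<lambda>y. S y - T y) z = double_div S z - double_div T z"
  by (simp add: double_div_def d_x_diff smooth_d_x assms sum_subtractf)

text \<open>Allows \<open>double_div_diff\<close> to separate the two sources, each of which
  contains \<open>p\<close> and \<open>\<sigma>\<close>.\<close>

lemma smooth_stress:
  assumes "smooth \<rho>" "smooth u" "smooth p" "smooth \<sigma>"
  shows "smooth (\<lambda>y. stress c \<rho>0 p0 \<rho> u p \<sigma> v y $ i $ j)"
  unfolding stress_def vec_lambda_beta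
  by (intro smooth_diff smooth_add smooth_mult smooth_const smooth_vec_nth assms)

lemma double_div_stress_diff:
  assumes \<rho>: "smooth \<rho>" and u: "smooth u"
  shows "double_div (\<lambda>y. stress c \<rho>0 p0 \<rho> u p \<sigma> 0 y - stress c \<rho>0 p0 \<rho> u p \<sigma> U y) z
    = 2 * advect U (\<lambda>y. \<Sum>j\<in>UNIV. d_x j (\<lambda>y. \<rho> y * u y $ j) y) z - advect U (advect U \<rho>) z"
proof -
  \<comment> \<open>The momentum density, whose divergence appears in the continuity
    residual.\<close>
  define m where "m j y = \<rho> y * u y $ j" for j y
  have m: "smooth (m j)" for j
    unfolding m_def by (intro smooth_mult smooth_vec_nth \<rho> u)
  \<comment> \<open>The terms quadratic in \<open>u\<close>, the pressure terms and
    \<open>\<sigma>\<close> cancel in the difference.\<close>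
  have entry: "(\<lambda>y. (stress c \<rho>0 p0 \<rho> u p \<sigma> 0 y - stress c \<rho>0 p0 \<rho> u p \<sigma> U y) $ i $ j)
      = (\<lambda>y. U $ i * m j y + U $ j * m i y - U $ i * U $ j * \<rho> y)" for i j
    by (simp add: stress_def m_def fun_eq_iff algebra_simps)
  have "double_div (\<lambda>y. stress c \<rho>0 p0 \<rho> u p \<sigma> 0 y - stress c \<rho>0 p0 \<rho> u p \<sigma> U y) z
    = (\<Sum>i\<in>UNIV. \<Sum>j\<in>UNIV. U $ i * d_x i (d_x j (m j)) z)
      + (\<Sum>i\<in>UNIV. \<Sum>j\<in>UNIV. U $ j * d_x j (d_x i (m i)) z)
      - (\<Sum>i\<in>UNIV. \<Sum>j\<in>UNIV. U $ i * U $ j * d_x i (d_x j \<rho>) z)"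
    unfolding double_div_def entry
    by (simp add: d_x_diff d_x_add d_x_cmult smooth_add smooth_cmult smooth_d_x m \<rho>
        sum.distrib sum_subtractf d_x_commute[OF m])
  \<comment> \<open>After commuting the partial derivatives, the second sum is the first with the
    indices interchanged; this produces the factor 2.\<close>
  also have "(\<Sum>i\<in>UNIV. \<Sum>j\<in>UNIV. U $ j * d_x j (d_x i (m i)) z)
      = (\<Sum>i\<in>UNIV. \<Sum>j\<in>UNIV. U $ i * d_x i (d_x j (m j)) z)"
    by (rule sum.swap)
  finally show ?thesis
    using advect_divergence[of m, OF m] advect_advect[OF \<rho>] by (simp add: m_def[abs_def])
qed

theorem lemma4:
  fixes c \<rho>0 p0 :: real
    and \<rho> p :: "'d::finite spacetime \<Rightarrow> real"
    and u :: "'d spacetime \<Rightarrow> real ^ 'd"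
    and \<sigma> :: "'d spacetime \<Rightarrow> real ^ 'd ^ 'd"
    and U :: "real ^ 'd"
  assumes "CARD('d) = 2 \<or> CARD('d) = 3"
    and "c > 0"
    and "smooth \<rho>" and "smooth u" and "smooth p" and "smooth \<sigma>"
  shows "(\<forall>z. double_div (\<lambda>y. stress c \<rho>0 p0 \<rho> u p \<sigma> 0 y - stress c \<rho>0 p0 \<rho> u p \<sigma> U y) z
              + (wave_op c U \<rho> z - wave_op c 0 \<rho> z)
            = 2 * advect U (continuity_residual \<rho> u) z)
       \<and> ((\<forall>z. continuity_residual \<rho> u z = 0) \<longrightarrow>
            (\<forall>z. double_div (stress c \<rho>0 p0 \<rho> u p \<sigma> U) z
               = double_div (stress c \<rho>0 p0 \<rho> u p \<sigma> 0) z
                 + (wave_op c U (\<lambda>y. \<rho> y - \<rho>0) z - wave_op c 0 (\<lambda>y. \<rho> y - \<rho>0) z)))"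
proof -
  note \<rho> = \<open>smooth \<rho>\<close> and u = \<open>smooth u\<close>
  let ?C = "continuity_residual \<rho> u"
  have "?C = (\<lambda>z. d_t \<rho> z + (\<Sum>j\<in>UNIV. d_x j (\<lambda>y. \<rho> y * u y $ j) z))"
    by (simp add: continuity_residual_def fun_eq_iff)
  moreover have "smooth (\<lambda>z. \<Sum>j\<in>UNIV. d_x j (\<lambda>y. \<rho> y * u y $ j) z)"
    by (intro smooth_sum smooth_d_x smooth_mult smooth_vec_nth \<rho> u)
  \<comment> \<open>The two \<open>advect U (advect U \<rho>)\<close> terms cancel; what remains is
    twice the advection of \<open>d_t \<rho>\<close> plus the divergence of the momentum.\<close>
  ultimately have identity:
    "double_div (\<lambda>y. stress c \<rho>0 p0 \<rho> u p \<sigma> 0 y - stress c \<rho>0 p0 \<rho> u p \<sigma> U y) z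
      + (wave_op c U \<rho> z - wave_op c 0 \<rho> z) = 2 * advect U ?C z" for z
    by (simp add: double_div_stress_diff wave_op_diff advect_add smooth_d_t \<rho> u)
  \<comment> \<open>The difference of the wave operators sees \<open>\<rho>\<close> only through
    first derivatives and their derivatives, so the ambient constant drops out.\<close>
  have shift: "wave_op c U (\<lambda>y. \<rho> y - \<rho>0) z - wave_op c 0 (\<lambda>y. \<rho> y - \<rho>0) z
      = wave_op c U \<rho> z - wave_op c 0 \<rho> z" for z
  proof -
    have "d_t (\<lambda>y. \<rho> y - \<rho>0) = d_t \<rho>"
      using d_t_add[OF \<rho> smooth_const[of "- \<rho>0"]] by (simp add: d_t_const)
    moreover have "advect U (\<lambda>y. \<rho> y - \<rho>0) = advect U \<rho>"
      by (simp add: advect_def fun_eq_iff d_x_diff \<rho> smooth_const d_x_const)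
    ultimately show ?thesis by (simp add: wave_op_diff smooth_diff smooth_const \<rho>)
  qed
  have conserved: "double_div (stress c \<rho>0 p0 \<rho> u p \<sigma> U) z
      = double_div (stress c \<rho>0 p0 \<rho> u p \<sigma> 0) z + (wave_op c U \<rho> z - wave_op c 0 \<rho> z)"
    if "\<forall>z. ?C z = 0" for z
  proof -
    \<comment> \<open>\<open>advect\<close> differentiates the residual, so it must vanish as a
      function, not just at one point.\<close>
    have "?C = (\<lambda>z. 0)" using that by auto
    then have "advect U ?C z = 0" by (simp add: advect_def d_x_const)
    with identity[of z] show ?thesis
      by (simp add: double_div_diff smooth_stress assms)
  qed
  show ?thesis using identity conserved by (simp add: shift)
qed

end
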